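(* Let $(V,\mathcal B,\mu)$ be a standard measure space and $\rho=(x\mapsto\rho_x)$ a measure on $(V\times V,\mathcal B\times\mathcal B)$ such that $c(x)=\rho_x(V)$ is finite. Let the measure $\nu=c\mu$ and the operators $R(f)(x)=\int_V f(y)\,d\rho_x(y)$ and $P(f)(x)=\frac1{c(x)}R(f)(x)$ be given, and let $P(x,\cdot)$ be the Markov process defined by the operator $P$. Then the following are equivalent: (i) $P(x,\cdot)$ is reversible; (ii) the Markov operator $P$ is self-adjoint in $L^2(\nu)$ and $\nu P=\nu$; (iii) $c(x)P(x,dy)\,d\mu(x)=c(y)P(y,dx)\,d\mu(y)$; (iv) the measure $\rho$ on $(V\times V,\mathcal B\times\mathcal B)$ defined by $\rho(A\times B)=\int_V\chi_A R(\chi_B)\,d\mu$ is symmetric, where $R(f)=cP(f)$; (v) the operator $R$ is symmetric.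
   Context: $\mu$ is a non-atomic $\sigma$-finite measure on a standard Borel space $(V,\mathcal B)$. The notation $\rho=(x\mapsto\rho_x)$ means that $x\mapsto\rho_x$ is a measurable family of measures on $(V,\mathcal B)$ with $\rho(f)=\int_V\big(\int_V f(x,y)\,d\rho_x(y)\big)d\mu(x)$. It is assumed that $0<c(x)<\infty$ for $\mu$-a.e. $x$ and $\int_A c\,d\mu<\infty$ whenever $\mu(A)<\infty$. Put $P(x,dy)=c(x)^{-1}d\rho_x(y)$, so $P(x,A)=P(\chi_A)(x)$. The process is reversible if, for any $A,B\in\mathcal B$, $\int_B c(x)P(x,A)\,d\mu(x)=\int_A c(x)P(x,B)\,d\mu(x)$. The measure $\rho$ is symmetric if $\rho(A\times B)=\rho(B\times A)$ for all $A,B\in\mathcal B$. The operator $R$ is symmetric if $\int_V fR(g)\,d\mu=\int_V R(f)g\,d\mu$ for any Borel functions $f,g$ on $V$ (integrals understood in the extended real line). The measure $\nu P$ is $(\nu P)(f)=\int_V P(f)\,d\nu$.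
   Formalization: Symmetry of R in (v) is required only for Borel f, g for which the double integrals of f(x)g(y) and f(y)g(x) against ρ exist in the extended real line; for arbitrary signed f, g the two iterated integrals can differ although ρ is symmetric, so (i)⇒(v) would fail. *)

theory Defs
  imports "HOL-Analysis.Analysis"
begin

definition standard_borel_space :: "'a measure \<Rightarrow> bool" where
  "standard_borel_space M \<longleftrightarrow>
    (\<exists>T. completely_metrizable_space T \<and> second_countable T \<and> topspace T = space M \<and>
         sets M = sigma_sets (space M) {U. openin T U})"

definition non_atomic :: "'a measure \<Rightarrow> bool" where
  "non_atomic M \<longleftrightarrow>
    (\<forall>A\<in>sets M. 0 < emeasure M A \<longrightarrow>
       (\<exists>B\<in>sets M. B \<subseteq> A \<and> 0 < emeasure M B \<and> emeasure M B < emeasure M A))"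

text \<open>
  The integral with values in the extended real line. It is meaningful for Borel functions whose
  positive or negative part has finite integral; otherwise it takes the value
  \<open>\<infinity> - \<infinity> = \<infinity>\<close>.
  Hence it is finite exactly when both parts have finite integral.
\<close>

definition ext_integral :: "'a measure \<Rightarrow> ('a \<Rightarrow> ereal) \<Rightarrow> ereal" where
  "ext_integral M f =
     enn2ereal (\<integral>\<^sup>+x. e2ennreal (f x) \<partial>M) - enn2ereal (\<integral>\<^sup>+x. e2ennreal (- f x) \<partial>M)"

definition ext_integral_exists :: "'a measure \<Rightarrow> ('a \<Rightarrow> ereal) \<Rightarrow> bool" where
  "ext_integral_exists M f \<longleftrightarrow>
     (\<integral>\<^sup>+x. e2ennreal (f x) \<partial>M) < \<infinity> \<or> (\<integral>\<^sup>+x. e2ennreal (- f x) \<partial>M) < \<infinity>"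

definition measurable_family :: "'a measure \<Rightarrow> ('a \<Rightarrow> 'a measure) \<Rightarrow> bool" where
  "measurable_family M \<kappa> \<longleftrightarrow>
     (\<forall>x\<in>space M. sets (\<kappa> x) = sets M) \<and>
     (\<forall>A\<in>sets M. (\<lambda>x. emeasure (\<kappa> x) A) \<in> borel_measurable M)"

text \<open>
  The relation written \<open>\<rho> = (x \<mapsto> \<rho>\<^sub>x)\<close>; the measure \<open>\<rho>\<^sub>x\<close> is \<open>\<kappa> x\<close>.
\<close>

definition has_fibres :: "('a \<times> 'a) measure \<Rightarrow> 'a measure \<Rightarrow> ('a \<Rightarrow> 'a measure) \<Rightarrow> bool" where
  "has_fibres \<rho> \<mu> \<kappa> \<longleftrightarrow>
     sets \<rho> = sets (\<mu> \<Otimes>\<^sub>M \<mu>) \<and> measurable_family \<mu> \<kappa> \<and>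
     (\<forall>f :: 'a \<times> 'a \<Rightarrow> ennreal. f \<in> borel_measurable (\<mu> \<Otimes>\<^sub>M \<mu>) \<longrightarrow>
        (\<integral>\<^sup>+z. f z \<partial>\<rho>) = (\<integral>\<^sup>+x. (\<integral>\<^sup>+y. f (x, y) \<partial>\<kappa> x) \<partial>\<mu>))"

definition fibre_mass :: "('a \<Rightarrow> 'a measure) \<Rightarrow> 'a \<Rightarrow> ennreal" where
  "fibre_mass \<kappa> x = emeasure (\<kappa> x) (space (\<kappa> x))"

definition nu :: "'a measure \<Rightarrow> ('a \<Rightarrow> 'a measure) \<Rightarrow> 'a measure" where
  "nu \<mu> \<kappa> = density \<mu> (fibre_mass \<kappa>)"

definition R_op :: "('a \<Rightarrow> 'a measure) \<Rightarrow> ('a \<Rightarrow> real) \<Rightarrow> 'a \<Rightarrow> ereal" where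
  "R_op \<kappa> f x = ext_integral (\<kappa> x) (\<lambda>y. ereal (f y))"

definition P_op :: "('a \<Rightarrow> 'a measure) \<Rightarrow> ('a \<Rightarrow> real) \<Rightarrow> 'a \<Rightarrow> ereal" where
  "P_op \<kappa> f x = 1 / enn2ereal (fibre_mass \<kappa> x) * R_op \<kappa> f x"

definition P_kernel :: "('a \<Rightarrow> 'a measure) \<Rightarrow> 'a \<Rightarrow> 'a measure" where
  "P_kernel \<kappa> x = scale_measure (1 / fibre_mass \<kappa> x) (\<kappa> x)"

lemma P_kernel_eq_P_op_indicator:
  assumes "A \<in> sets (\<kappa> x)" "0 < fibre_mass \<kappa> x" "fibre_mass \<kappa> x < \<infinity>"
  shows "enn2ereal (emeasure (P_kernel \<kappa> x) A) = P_op \<kappa> (indicator A) x"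
proof -
  have pos: "e2ennreal (ereal (indicator A y)) = indicator A y" for y
    by (simp add: indicator_def)
  have neg: "e2ennreal (- ereal (indicator A y)) = 0" for y
    by (simp add: indicator_def e2ennreal_neg ennreal_neg)
  have R: "R_op \<kappa> (indicator A) x = enn2ereal (emeasure (\<kappa> x) A)"
    using assms(1) unfolding R_op_def ext_integral_def pos neg by (simp add: zero_ennreal.rep_eq)
  have "enn2ereal (1 / fibre_mass \<kappa> x) = 1 / enn2ereal (fibre_mass \<kappa> x)"
    by (simp add: divide_ennreal_def divide_ereal_def inverse_ennreal.rep_eq)
  then show ?thesis
    by (simp add: P_kernel_def P_op_def R times_ennreal.rep_eq)
qed

definition reversible :: "'a measure \<Rightarrow> ('a \<Rightarrow> 'a measure) \<Rightarrow> bool" where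
  "reversible \<mu> \<kappa> \<longleftrightarrow>
     (\<forall>A\<in>sets \<mu>. \<forall>B\<in>sets \<mu>.
        (\<integral>\<^sup>+x\<in>B. fibre_mass \<kappa> x * emeasure (P_kernel \<kappa> x) A \<partial>\<mu>) =
        (\<integral>\<^sup>+x\<in>A. fibre_mass \<kappa> x * emeasure (P_kernel \<kappa> x) B \<partial>\<mu>))"

definition L2 :: "'a measure \<Rightarrow> ('a \<Rightarrow> real) set" where
  "L2 M = {f \<in> borel_measurable M. integrable M (\<lambda>x. (f x)\<^sup>2)}"

text \<open>
  An operator with domain all of \<open>L\<^sup>2\<close>, so that self-adjointness is the identity
  \<open>\<langle>T f, g\<rangle> = \<langle>f, T g\<rangle>\<close>. This identity
  makes \<open>T\<close> linear and well defined modulo null functions, and bounded by Hellinger--Toeplitz.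
\<close>

definition self_adjoint_on_L2 :: "'a measure \<Rightarrow> (('a \<Rightarrow> real) \<Rightarrow> 'a \<Rightarrow> ereal) \<Rightarrow> bool" where
  "self_adjoint_on_L2 M T \<longleftrightarrow>
     (\<forall>f\<in>L2 M. (AE x in M. \<bar>T f x\<bar> \<noteq> \<infinity>) \<and> (\<lambda>x. real_of_ereal (T f x)) \<in> L2 M) \<and>
     (\<forall>f\<in>L2 M. \<forall>g\<in>L2 M.
        (\<integral>x. real_of_ereal (T f x) * g x \<partial>M) = (\<integral>x. f x * real_of_ereal (T g x) \<partial>M))"

text \<open>The identity \<open>M T = M\<close> of measures, where \<open>(M T)(f) = \<integral> T(f) dM\<close>.\<close>

definition invariant_measure :: "'a measure \<Rightarrow> (('a \<Rightarrow> real) \<Rightarrow> 'a \<Rightarrow> ereal) \<Rightarrow> bool" where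
  "invariant_measure M T \<longleftrightarrow>
     (\<forall>f\<in>borel_measurable M. (\<forall>x\<in>space M. 0 \<le> f x) \<longrightarrow>
        ext_integral M (T f) = ext_integral M (\<lambda>x. ereal (f x)))"

text \<open>
  The identity \<open>c(x) P(x,dy) d\<mu>(x) = c(y) P(y,dx) d\<mu>(y)\<close> of measures in \<open>(x, y)\<close>, evaluated on an
  arbitrary measurable subset of the product.
\<close>

definition detailed_balance :: "'a measure \<Rightarrow> ('a \<Rightarrow> 'a measure) \<Rightarrow> bool" where
  "detailed_balance \<mu> \<kappa> \<longleftrightarrow>
     (\<forall>E\<in>sets (\<mu> \<Otimes>\<^sub>M \<mu>).
        (\<integral>\<^sup>+x. fibre_mass \<kappa> x * (\<integral>\<^sup>+y. indicator E (x, y) \<partial>P_kernel \<kappa> x) \<partial>\<mu>) =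
        (\<integral>\<^sup>+y. fibre_mass \<kappa> y * (\<integral>\<^sup>+x. indicator E (x, y) \<partial>P_kernel \<kappa> y) \<partial>\<mu>))"

definition symmetric_measure :: "'a measure \<Rightarrow> ('a \<times> 'a) measure \<Rightarrow> bool" where
  "symmetric_measure M \<rho> \<longleftrightarrow>
     (\<forall>A\<in>sets M. \<forall>B\<in>sets M. emeasure \<rho> (A \<times> B) = emeasure \<rho> (B \<times> A))"

text \<open>
  The Borel functions may be signed and the integrals infinite. The identity is required whenever
  the double integrals of \<open>f(x) g(y)\<close> and \<open>f(y) g(x)\<close> against \<open>\<rho>\<close> exist in the extended real line,
  which includes all nonnegative \<open>f\<close> and \<open>g\<close>. Existence of the two iterated integrals alone would
  not do: as for a symmetric infinite matrix, they may then differ although \<open>\<rho>\<close> is symmetric.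
\<close>

definition symmetric_operator ::
  "'a measure \<Rightarrow> ('a \<times> 'a) measure \<Rightarrow> (('a \<Rightarrow> real) \<Rightarrow> 'a \<Rightarrow> ereal) \<Rightarrow> bool" where
  "symmetric_operator \<mu> \<rho> T \<longleftrightarrow>
     (\<forall>f\<in>borel_measurable \<mu>. \<forall>g\<in>borel_measurable \<mu>.
        ext_integral_exists \<rho> (\<lambda>(x, y). ereal (f x * g y)) \<longrightarrow>
        ext_integral_exists \<rho> (\<lambda>(x, y). ereal (f y * g x)) \<longrightarrow>
        ext_integral \<mu> (\<lambda>x. ereal (f x) * T g x) = ext_integral \<mu> (\<lambda>x. T f x * ereal (g x)))"

end

theory Submission
  imports Defs
begin

text \<open>
  Every condition says, in its own language, that \<open>\<rho>\<close> is invariant under the reflection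
  \<open>(x, y) \<mapsto> (y, x)\<close>, and each is compared with symmetry of \<open>\<rho>\<close> on rectangles.

  For reversibility this is immediate: since \<open>c(x) P(x, A) = \<rho>\<^sub>x(A)\<close> almost everywhere, the two sides are
  \<open>\<rho>(B \<times> A)\<close> and \<open>\<rho>(A \<times> B)\<close>. Detailed balance is the same identity for all measurable sets. It follows
  from the one on rectangles by uniqueness of measures, because \<open>\<rho>\<close> is \<open>\<sigma>\<close>-finite on rectangles
  (\<open>distr_swap_eq\<close>).

  For \<open>R\<close>, the key is the Fubini identity \<open>\<integral> f R(g) d\<mu> = \<integral> f(x) g(y) d\<rho>\<close> with values in the extended real line
  (\<open>ext_integral_mult_R_op\<close>), valid whenever the right side exists. It turns symmetry of \<open>R\<close> into
  invariance of \<open>\<rho>\<close> under reflection, and with indicators it also gives the formula for \<open>\<rho>(A \<times> B)\<close>.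

  For \<open>P\<close>, the first marginal of \<open>\<rho>\<close> is \<open>\<nu>\<close> and the second is \<open>\<nu>P\<close>, so invariance of \<open>\<nu>\<close> is equality of the
  marginals of a symmetric measure. Given this, the Cauchy-Schwarz inequality on the fibres shows that
  \<open>P\<close> maps \<open>L\<^sup>2(\<nu>)\<close> to itself (\<open>P_op_L2\<close>), and self-adjointness is the symmetry of \<open>R\<close> because the factors
  \<open>c\<close> and \<open>1/c\<close> cancel (\<open>integral_P_op_mult\<close>). Conversely, self-adjointness on indicators is symmetry on
  rectangles with sides of finite \<open>\<nu>\<close>-measure, and these exhaust all rectangles
  (\<open>symmetric_of_self_adjoint\<close>).
\<close>

section \<open>Extended arithmetic\<close>

lemma ennreal_mult_inverse_cancel:
  fixes c r :: ennreal
  assumes "0 < c" "c < \<infinity>"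
  shows "c * (1 / c * r) = r"
  using assms
  by (cases c) (auto simp: divide_ennreal_def inverse_ennreal mult.assoc[symmetric] ennreal_mult[symmetric])

lemma e2ennreal_enn2ereal_mult: "e2ennreal (enn2ereal c * t) = c * e2ennreal t"
proof (cases "0 \<le> t")
  case True
  then have "enn2ereal c * t = enn2ereal (c * e2ennreal t)"
    by (simp add: times_ennreal.rep_eq enn2ereal_e2ennreal)
  then show ?thesis by simp
next
  case False
  then show ?thesis
    by (simp add: e2ennreal_neg ereal_mult_le_0_iff)
qed

lemma enn2ereal_diff_eqI:
  fixes p q a b :: ennreal
  assumes "p + b = q + a" "p \<le> a" "q \<le> b" "a < \<infinity> \<or> b < \<infinity>"
  shows "enn2ereal p - enn2ereal q = enn2ereal a - enn2ereal b"
  using assms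
  by (cases p; cases q; cases a; cases b)
     (auto simp: ennreal_plus[symmetric] top_unique simp del: ennreal_plus)

text \<open>
  A negative factor exchanges the positive and the negative part, hence the two summands in \<open>p\<close> and
  \<open>q\<close>. The convention \<open>\<infinity> - \<infinity> = \<infinity>\<close> breaks distributivity for \<open>r < 0\<close>, so one of the products has to
  be finite.
\<close>

lemma ereal_mult_diff_enn2ereal:
  fixes a b :: ennreal and r :: real
  defines "p \<equiv> ennreal r * a + ennreal (- r) * b" and "q \<equiv> ennreal (- r) * a + ennreal r * b"
  assumes "p < \<infinity> \<or> q < \<infinity>"
  shows "ereal r * (enn2ereal a - enn2ereal b) = enn2ereal p - enn2ereal q"
proof (cases r "0 :: real" rule: linorder_cases)
  case less
  define s where "s = - r"
  with less have s: "r = - s" "0 < s" by simp_all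
  then have "p = ennreal s * b" "q = ennreal s * a"
    by (simp_all add: p_def q_def ennreal_neg)
  with s assms(3) show ?thesis
    by (cases a; cases b) (auto simp: ennreal_mult[symmetric] ennreal_mult_top algebra_simps)
next
  case equal
  then show ?thesis
    by (simp add: p_def q_def zero_ennreal.rep_eq flip: zero_ereal_def)
next
  case greater
  then have "p = ennreal r * a" "q = ennreal r * b"
    by (simp_all add: p_def q_def ennreal_neg)
  with greater assms(3) show ?thesis
    by (cases a; cases b) (auto simp: ennreal_mult[symmetric] ennreal_mult_top algebra_simps)
qed

section \<open>The integral with values in the extended real line\<close>

lemma ext_integral_cong_AE:
  assumes "AE x in M. f x = g x"
  shows "ext_integral M f = ext_integral M g"
proof -
  have "(\<integral>\<^sup>+x. e2ennreal (f x) \<partial>M) = (\<integral>\<^sup>+x. e2ennreal (g x) \<partial>M)"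
    "(\<integral>\<^sup>+x. e2ennreal (- f x) \<partial>M) = (\<integral>\<^sup>+x. e2ennreal (- g x) \<partial>M)"
    using assms by (auto intro!: nn_integral_cong_AE)
  then show ?thesis
    by (simp add: ext_integral_def)
qed

lemma ext_integral_nonneg:
  assumes "AE x in M. 0 \<le> f x"
  shows "ext_integral M f = enn2ereal (\<integral>\<^sup>+x. e2ennreal (f x) \<partial>M)"
proof -
  have "(\<integral>\<^sup>+x. e2ennreal (- f x) \<partial>M) = (\<integral>\<^sup>+x. 0 \<partial>M)"
    using assms by (intro nn_integral_cong_AE) (auto simp: e2ennreal_neg)
  then show ?thesis
    by (simp add: ext_integral_def zero_ennreal.rep_eq)
qed

text \<open>
  The positive part of \<open>a - b\<close> is at most \<open>a\<close> and its negative part at most \<open>b\<close>, yet integrals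
  of different decompositions agree: \<open>(a - b)\<^sup>+ + b = (a - b)\<^sup>- + a\<close> pointwise, and the integrals of this
  identity can be rearranged as soon as \<open>a\<close> or \<open>b\<close> has finite integral.
\<close>

lemma ext_integral_diff:
  fixes a b :: "'a \<Rightarrow> ennreal"
  assumes [measurable]: "a \<in> borel_measurable M" "b \<in> borel_measurable M"
    and fin: "(\<integral>\<^sup>+x. a x \<partial>M) < \<infinity> \<or> (\<integral>\<^sup>+x. b x \<partial>M) < \<infinity>"
    and h: "AE x in M. a x < \<infinity> \<or> b x < \<infinity> \<longrightarrow> h x = enn2ereal (a x) - enn2ereal (b x)"
  shows "ext_integral M h = enn2ereal (\<integral>\<^sup>+x. a x \<partial>M) - enn2ereal (\<integral>\<^sup>+x. b x \<partial>M)"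
proof -
  have ab: "AE x in M. a x < \<infinity> \<or> b x < \<infinity>"
    using fin nn_integral_PInf_AE[of a M] nn_integral_PInf_AE[of b M]
    by (auto simp: less_top elim!: AE_mp)
  have pos: "(\<integral>\<^sup>+x. e2ennreal (h x) \<partial>M) = (\<integral>\<^sup>+x. a x - b x \<partial>M)"
    using h ab by (intro nn_integral_cong_AE) auto
  have "AE x in M. e2ennreal (- h x) = b x - a x"
    using h ab
  proof eventually_elim
    fix x assume x: "a x < \<infinity> \<or> b x < \<infinity> \<longrightarrow> h x = enn2ereal (a x) - enn2ereal (b x)" "a x < \<infinity> \<or> b x < \<infinity>"
    then have "- h x = enn2ereal (b x) - enn2ereal (a x)"
      by (cases "a x"; cases "b x") auto
    then show "e2ennreal (- h x) = b x - a x"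
      by simp
  qed
  then have neg: "(\<integral>\<^sup>+x. e2ennreal (- h x) \<partial>M) = (\<integral>\<^sup>+x. b x - a x \<partial>M)"
    by (rule nn_integral_cong_AE)
  \<comment> \<open>For truncated subtraction both sides are the maximum of the two, also where one of them is infinite.\<close>
  have parts: "(u - v) + v = (v - u) + u" for u v :: ennreal
    using linear[of u v]
    by (cases "u = top \<or> v = top") (auto simp: diff_add_cancel_ennreal diff_eq_0_ennreal less_top)
  have "(\<integral>\<^sup>+x. a x - b x \<partial>M) + (\<integral>\<^sup>+x. b x \<partial>M) = (\<integral>\<^sup>+x. b x - a x \<partial>M) + (\<integral>\<^sup>+x. a x \<partial>M)"
    by (simp add: nn_integral_add[symmetric] parts)
  moreover have "(\<integral>\<^sup>+x. a x - b x \<partial>M) \<le> (\<integral>\<^sup>+x. a x \<partial>M)" "(\<integral>\<^sup>+x. b x - a x \<partial>M) \<le> (\<integral>\<^sup>+x. b x \<partial>M)"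
    by (auto intro!: nn_integral_mono diff_le_self_ennreal)
  ultimately show ?thesis
    using fin unfolding ext_integral_def pos neg by (intro enn2ereal_diff_eqI) auto
qed

section \<open>Products of square-integrable functions\<close>

lemma abs_mult_le_sum_squares: "\<bar>a * b\<bar> \<le> a\<^sup>2 + (b :: real)\<^sup>2"
proof -
  have "\<bar>a * b\<bar> \<le> 2 * (\<bar>a\<bar> * \<bar>b\<bar>)"
    by (simp add: abs_mult)
  also have "\<dots> \<le> a\<^sup>2 + b\<^sup>2"
    using sum_squares_bound[of "\<bar>a\<bar>" "\<bar>b\<bar>"] by (simp add: mult.assoc)
  finally show ?thesis .
qed

lemma L2_mult_integrable:
  assumes "f \<in> L2 M" "g \<in> L2 M"
  shows "integrable M (\<lambda>x. f x * g x)"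
proof (rule Bochner_Integration.integrable_bound)
  show "integrable M (\<lambda>x. (f x)\<^sup>2 + (g x)\<^sup>2)" "(\<lambda>x. f x * g x) \<in> borel_measurable M"
    using assms by (auto simp: L2_def)
  have "\<bar>a * b\<bar> \<le> a\<^sup>2 + b\<^sup>2" for a b :: real
    using abs_mult_le_sum_squares .
  then show "AE x in M. norm (f x * g x) \<le> norm ((f x)\<^sup>2 + (g x)\<^sup>2)"
    by simp
qed

section \<open>Measures on the square given by their fibres\<close>

text \<open>
  The mass \<open>c(x) = \<rho>\<^sub>x(V)\<close> may be \<open>0\<close> or \<open>\<infinity>\<close> on a \<open>\<mu>\<close>-null set; there division by it is meaningless, and
  statements about \<open>P\<close> hold almost everywhere.
\<close>

locale fibred_measure = sigma_finite_measure \<mu>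
  for \<mu> :: "'a measure" +
  fixes \<rho> :: "('a \<times> 'a) measure" and \<kappa> :: "'a \<Rightarrow> 'a measure"
  assumes fibres: "has_fibres \<rho> \<mu> \<kappa>"
    and mass: "AE x in \<mu>. 0 < fibre_mass \<kappa> x \<and> fibre_mass \<kappa> x < \<infinity>"
    and finite_mass: "\<And>A. A \<in> sets \<mu> \<Longrightarrow> emeasure \<mu> A < \<infinity> \<Longrightarrow> (\<integral>\<^sup>+x\<in>A. fibre_mass \<kappa> x \<partial>\<mu>) < \<infinity>"
begin

lemma sets_\<rho> [measurable_cong]: "sets \<rho> = sets (\<mu> \<Otimes>\<^sub>M \<mu>)"
  using fibres by (simp add: has_fibres_def)

lemma space_\<rho>: "space \<rho> = space \<mu> \<times> space \<mu>"
  using sets_eq_imp_space_eq[OF sets_\<rho>] by (simp add: space_pair_measure)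

lemma sets_\<kappa>: "x \<in> space \<mu> \<Longrightarrow> sets (\<kappa> x) = sets \<mu>"
  using fibres by (simp add: has_fibres_def measurable_family_def)

lemma space_\<kappa>: "x \<in> space \<mu> \<Longrightarrow> space (\<kappa> x) = space \<mu>"
  by (rule sets_eq_imp_space_eq[OF sets_\<kappa>])

lemma measurable_\<kappa>: "x \<in> space \<mu> \<Longrightarrow> borel_measurable (\<kappa> x) = borel_measurable \<mu>"
  by (rule measurable_cong_sets[OF sets_\<kappa>]) auto

lemma fibre_mass_eq: "x \<in> space \<mu> \<Longrightarrow> fibre_mass \<kappa> x = emeasure (\<kappa> x) (space \<mu>)"
  by (simp add: fibre_mass_def space_\<kappa>)

lemma nn_integral_\<rho>:
  assumes "f \<in> borel_measurable (\<mu> \<Otimes>\<^sub>M \<mu>)"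
  shows "(\<integral>\<^sup>+z. f z \<partial>\<rho>) = (\<integral>\<^sup>+x. (\<integral>\<^sup>+y. f (x, y) \<partial>\<kappa> x) \<partial>\<mu>)"
  using fibres assms by (simp add: has_fibres_def)

lemma measurable_emeasure_\<kappa> [measurable]:
  "A \<in> sets \<mu> \<Longrightarrow> (\<lambda>x. emeasure (\<kappa> x) A) \<in> borel_measurable \<mu>"
  using fibres by (simp add: has_fibres_def measurable_family_def)

lemma measurable_fibre_mass [measurable]: "fibre_mass \<kappa> \<in> borel_measurable \<mu>"
  using measurable_emeasure_\<kappa>[OF sets.top] fibre_mass_eq by (simp cong: measurable_cong)

text \<open>
  The fibres are finite only outside a null set, so measurability of integrals over them is built up
  from indicators instead of being read off from results on finite kernels. Functions of one variable
  are enough, because the fibre integrals of \<open>f(x) g(y)\<close> reduce to them.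
\<close>

lemma measurable_nn_integral_\<kappa>:
  assumes "g \<in> borel_measurable \<mu>"
  shows "(\<lambda>x. \<integral>\<^sup>+y. g y \<partial>\<kappa> x) \<in> borel_measurable \<mu>"
  using assms
proof (induction rule: borel_measurable_induct)
  case (cong f g)
  have "(\<integral>\<^sup>+y. f y \<partial>\<kappa> x) = (\<integral>\<^sup>+y. g y \<partial>\<kappa> x)" if "x \<in> space \<mu>" for x
    using that cong by (intro nn_integral_cong) (simp add: space_\<kappa>)
  with cong show ?case by (simp cong: measurable_cong)
next
  case (set A)
  then have "(\<integral>\<^sup>+y. indicator A y \<partial>\<kappa> x) = emeasure (\<kappa> x) A" if "x \<in> space \<mu>" for x
    using that by (simp add: sets_\<kappa>)
  with set show ?case by (simp cong: measurable_cong)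
next
  case (mult u r)
  then have "(\<integral>\<^sup>+y. r * u y \<partial>\<kappa> x) = r * (\<integral>\<^sup>+y. u y \<partial>\<kappa> x)" if "x \<in> space \<mu>" for x
    using that by (simp add: nn_integral_cmult measurable_\<kappa>)
  with mult show ?case by (simp cong: measurable_cong)
next
  case (add u v)
  then have "(\<integral>\<^sup>+y. v y + u y \<partial>\<kappa> x) = (\<integral>\<^sup>+y. v y \<partial>\<kappa> x) + (\<integral>\<^sup>+y. u y \<partial>\<kappa> x)" if "x \<in> space \<mu>" for x
    using that by (simp add: nn_integral_add measurable_\<kappa>)
  with add show ?case by (simp cong: measurable_cong)
next
  case (seq U)
  then have "(\<integral>\<^sup>+y. (SUP i. U i) y \<partial>\<kappa> x) = (SUP i. \<integral>\<^sup>+y. U i y \<partial>\<kappa> x)" if "x \<in> space \<mu>" for x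
    using that by (simp add: nn_integral_monotone_convergence_SUP[symmetric] measurable_\<kappa> image_comp)
  with seq show ?case by (simp cong: measurable_cong)
qed

lemma emeasure_\<rho>_Times:
  assumes [measurable]: "A \<in> sets \<mu>" "B \<in> sets \<mu>"
  shows "emeasure \<rho> (A \<times> B) = (\<integral>\<^sup>+x\<in>A. emeasure (\<kappa> x) B \<partial>\<mu>)"
proof -
  have "emeasure \<rho> (A \<times> B) = (\<integral>\<^sup>+z. indicator (A \<times> B) z \<partial>\<rho>)"
    by simp
  also have "\<dots> = (\<integral>\<^sup>+x. (\<integral>\<^sup>+y. indicator (A \<times> B) (x, y) \<partial>\<kappa> x) \<partial>\<mu>)"
    by (rule nn_integral_\<rho>) measurable
  also have "\<dots> = (\<integral>\<^sup>+x\<in>A. emeasure (\<kappa> x) B \<partial>\<mu>)"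
    by (intro nn_integral_cong)
       (simp add: indicator_times nn_integral_cmult sets_\<kappa> measurable_\<kappa> mult.commute)
  finally show ?thesis .
qed

lemma mass_mult_nn_integral_P_kernel:
  assumes "x \<in> space \<mu>" "0 < fibre_mass \<kappa> x" "fibre_mass \<kappa> x < \<infinity>" "f \<in> borel_measurable \<mu>"
  shows "fibre_mass \<kappa> x * (\<integral>\<^sup>+y. f y \<partial>P_kernel \<kappa> x) = (\<integral>\<^sup>+y. f y \<partial>\<kappa> x)"
  using assms by (simp add: P_kernel_def nn_integral_scale_measure measurable_\<kappa> ennreal_mult_inverse_cancel)

lemma reversible_iff_symmetric: "reversible \<mu> \<kappa> \<longleftrightarrow> symmetric_measure \<mu> \<rho>"
proof -
  have "(\<integral>\<^sup>+x\<in>B. fibre_mass \<kappa> x * emeasure (P_kernel \<kappa> x) A \<partial>\<mu>) = emeasure \<rho> (B \<times> A)"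
    if "A \<in> sets \<mu>" "B \<in> sets \<mu>" for A B
    unfolding emeasure_\<rho>_Times[OF that(2,1)] using mass
    by (intro nn_integral_cong_AE) (auto simp: P_kernel_def ennreal_mult_inverse_cancel)
  then show ?thesis
    unfolding reversible_def symmetric_measure_def by (metis (no_types, lifting))
qed

text \<open>
  The strips \<open>A \<times> V\<close> with \<open>\<mu>(A) < \<infinity>\<close> have \<open>\<rho>\<close>-measure \<open>\<integral>\<chi>\<^sub>A c d\<mu>\<close>, which is finite. So \<open>\<rho>\<close> is \<open>\<sigma>\<close>-finite on
  rectangles, which is what the uniqueness theorem for measures needs.
\<close>

lemma exhaustion:
  obtains A :: "nat \<Rightarrow> 'a set" where "range A \<subseteq> sets \<mu>" "incseq A" "(\<Union>n. A n) = space \<mu>"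
    "\<And>n. emeasure \<rho> (A n \<times> space \<mu>) < \<infinity>"
proof -
  obtain A :: "nat \<Rightarrow> 'a set" where A: "range A \<subseteq> sets \<mu>" "(\<Union>n. A n) = space \<mu>"
    "\<And>n. emeasure \<mu> (A n) \<noteq> \<infinity>" "incseq A"
    using sigma_finite_incseq by metis
  have "emeasure \<rho> (A n \<times> space \<mu>) < \<infinity>" for n
  proof -
    have "emeasure \<rho> (A n \<times> space \<mu>) = (\<integral>\<^sup>+x\<in>A n. fibre_mass \<kappa> x \<partial>\<mu>)"
      using A(1) by (subst emeasure_\<rho>_Times) (auto intro!: nn_integral_cong simp: fibre_mass_eq)
    also have "\<dots> < \<infinity>"
      using A(1,3) by (intro finite_mass) (auto simp: less_top)
    finally show ?thesis .
  qed
  with A show ?thesis using that by blast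
qed

text \<open>
  Rectangles form a generator closed under intersections and contain an exhaustion by sets of finite
  measure, so symmetry on rectangles determines \<open>\<rho>\<close> and its reflection to be equal.
\<close>

lemma distr_swap_eq:
  assumes "symmetric_measure \<mu> \<rho>"
  shows "distr \<rho> (\<mu> \<Otimes>\<^sub>M \<mu>) prod.swap = \<rho>"
proof -
  obtain A :: "nat \<Rightarrow> 'a set" where A: "range A \<subseteq> sets \<mu>" "(\<Union>n. A n) = space \<mu>"
    "\<And>n. emeasure \<rho> (A n \<times> space \<mu>) < \<infinity>"
    using exhaustion by metis
  have swap: "prod.swap \<in> \<mu> \<Otimes>\<^sub>M \<mu> \<rightarrow>\<^sub>M \<mu> \<Otimes>\<^sub>M \<mu>"
    unfolding prod.swap_def by measurable
  have "\<rho> = distr \<rho> (\<mu> \<Otimes>\<^sub>M \<mu>) prod.swap"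
  proof (rule measure_eqI_generator_eq[where E = "{a \<times> b |a b. a \<in> sets \<mu> \<and> b \<in> sets \<mu>}"
        and \<Omega> = "space \<mu> \<times> space \<mu>" and A = "\<lambda>n. A n \<times> space \<mu>"])
    show "Int_stable {a \<times> b |a b. a \<in> sets \<mu> \<and> b \<in> sets \<mu>}"
      by (rule Int_stable_pair_measure_generator)
    show "{a \<times> b |a b. a \<in> sets \<mu> \<and> b \<in> sets \<mu>} \<subseteq> Pow (space \<mu> \<times> space \<mu>)"
      by (rule pair_measure_closed)
    fix X assume "X \<in> {a \<times> b |a b. a \<in> sets \<mu> \<and> b \<in> sets \<mu>}"
    then obtain a b where X: "X = a \<times> b" and ab [measurable]: "a \<in> sets \<mu>" "b \<in> sets \<mu>"
      by auto
    have "prod.swap -` X \<inter> space \<rho> = b \<times> a"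
      using sets.sets_into_space[OF ab(1)] sets.sets_into_space[OF ab(2)] by (auto simp: X space_\<rho>)
    then show "emeasure \<rho> X = emeasure (distr \<rho> (\<mu> \<Otimes>\<^sub>M \<mu>) prod.swap) X"
      using assms ab swap by (subst emeasure_distr) (auto simp: X symmetric_measure_def measurable_cong_sets[OF sets_\<rho> refl])
  next
    show "sets \<rho> = sigma_sets (space \<mu> \<times> space \<mu>) {a \<times> b |a b. a \<in> sets \<mu> \<and> b \<in> sets \<mu>}"
      by (simp add: sets_\<rho> sets_pair_measure)
    show "sets (distr \<rho> (\<mu> \<Otimes>\<^sub>M \<mu>) prod.swap) = sigma_sets (space \<mu> \<times> space \<mu>) {a \<times> b |a b. a \<in> sets \<mu> \<and> b \<in> sets \<mu>}"
      by (simp add: sets_pair_measure)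
    show "range (\<lambda>n. A n \<times> space \<mu>) \<subseteq> {a \<times> b |a b. a \<in> sets \<mu> \<and> b \<in> sets \<mu>}"
      using A(1) by auto
    show "(\<Union>n. A n \<times> space \<mu>) = space \<mu> \<times> space \<mu>"
      using A(2) by auto
    show "emeasure \<rho> (A n \<times> space \<mu>) \<noteq> \<infinity>" for n
      using A(3)[of n] by auto
  qed
  then show ?thesis by simp
qed

lemma nn_integral_swap:
  assumes "symmetric_measure \<mu> \<rho>" and f [measurable]: "f \<in> borel_measurable (\<mu> \<Otimes>\<^sub>M \<mu>)"
  shows "(\<integral>\<^sup>+(x, y). f (y, x) \<partial>\<rho>) = (\<integral>\<^sup>+z. f z \<partial>\<rho>)"
proof -
  have swap: "prod.swap \<in> \<rho> \<rightarrow>\<^sub>M \<mu> \<Otimes>\<^sub>M \<mu>"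
    unfolding prod.swap_def by measurable
  have "(\<integral>\<^sup>+z. f z \<partial>\<rho>) = (\<integral>\<^sup>+z. f z \<partial>distr \<rho> (\<mu> \<Otimes>\<^sub>M \<mu>) prod.swap)"
    by (simp add: distr_swap_eq[OF assms(1)])
  also have "\<dots> = (\<integral>\<^sup>+(x, y). f (y, x) \<partial>\<rho>)"
    using swap by (simp add: nn_integral_distr prod.swap_def case_prod_unfold)
  finally show ?thesis by simp
qed

text \<open>
  Multiplying by \<open>c(x)\<close> undoes the normalisation of \<open>P(x, dy)\<close>. The left side of detailed balance is then
  \<open>\<rho>(E)\<close>, the right side the measure of \<open>E\<close> under the reflection of \<open>\<rho>\<close>.
\<close>

lemma detailed_balance_iff_symmetric: "detailed_balance \<mu> \<kappa> \<longleftrightarrow> symmetric_measure \<mu> \<rho>"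
proof -
  have l: "(\<integral>\<^sup>+x. fibre_mass \<kappa> x * (\<integral>\<^sup>+y. f (x, y) \<partial>P_kernel \<kappa> x) \<partial>\<mu>) = (\<integral>\<^sup>+z. f z \<partial>\<rho>)"
    if f: "f \<in> borel_measurable (\<mu> \<Otimes>\<^sub>M \<mu>)" for f
    unfolding nn_integral_\<rho>[OF f] using mass AE_space f
    by (intro nn_integral_cong_AE) (auto intro!: mass_mult_nn_integral_P_kernel measurable_Pair2)
  have r: "(\<integral>\<^sup>+y. fibre_mass \<kappa> y * (\<integral>\<^sup>+x. f (x, y) \<partial>P_kernel \<kappa> y) \<partial>\<mu>) = (\<integral>\<^sup>+(x, y). f (y, x) \<partial>\<rho>)"
    if [measurable]: "f \<in> borel_measurable (\<mu> \<Otimes>\<^sub>M \<mu>)" for f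
    using l[of "\<lambda>(x, y). f (y, x)"] by simp
  show ?thesis
  proof
    assume "symmetric_measure \<mu> \<rho>"
    then show "detailed_balance \<mu> \<kappa>"
      unfolding detailed_balance_def by (simp add: l r nn_integral_swap)
  next
    assume db: "detailed_balance \<mu> \<kappa>"
    have "emeasure \<rho> (A \<times> B) = emeasure \<rho> (B \<times> A)"
      if [measurable]: "A \<in> sets \<mu>" "B \<in> sets \<mu>" for A B
    proof -
      have "emeasure \<rho> (A \<times> B) = (\<integral>\<^sup>+z. indicator (A \<times> B) z \<partial>\<rho>)"
        by simp
      also have "\<dots> = (\<integral>\<^sup>+(x, y). indicator (A \<times> B) (y, x) \<partial>\<rho>)"
        using db l[of "indicator (A \<times> B)"] r[of "indicator (A \<times> B)"]
        unfolding detailed_balance_def by simp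
      also have "\<dots> = (\<integral>\<^sup>+z. indicator (B \<times> A) z \<partial>\<rho>)"
        by (intro nn_integral_cong) (auto simp: indicator_def)
      finally show ?thesis by simp
    qed
    then show "symmetric_measure \<mu> \<rho>"
      by (simp add: symmetric_measure_def)
  qed
qed


section \<open>The operator \<open>R\<close>\<close>

lemma measurable_R_op:
  assumes [measurable]: "f \<in> borel_measurable \<mu>"
  shows "R_op \<kappa> f \<in> borel_measurable \<mu>"
proof -
  have [measurable]: "(\<lambda>x. \<integral>\<^sup>+y. ennreal (f y) \<partial>\<kappa> x) \<in> borel_measurable \<mu>"
    "(\<lambda>x. \<integral>\<^sup>+y. ennreal (- f y) \<partial>\<kappa> x) \<in> borel_measurable \<mu>"
    by (auto intro!: measurable_nn_integral_\<kappa>)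
  show ?thesis
    unfolding R_op_def[abs_def] ext_integral_def by simp
qed

lemma nn_integral_\<kappa>_mult:
  assumes x: "x \<in> space \<mu>" and [measurable]: "g \<in> borel_measurable \<mu>"
  shows "(\<integral>\<^sup>+y. ennreal (r * g y) \<partial>\<kappa> x) =
    ennreal r * (\<integral>\<^sup>+y. ennreal (g y) \<partial>\<kappa> x) + ennreal (- r) * (\<integral>\<^sup>+y. ennreal (- g y) \<partial>\<kappa> x)"
proof (cases "0 \<le> r")
  case True
  then show ?thesis
    by (simp add: ennreal_mult' nn_integral_cmult measurable_\<kappa>[OF x] ennreal_neg)
next
  case False
  then have "ennreal (r * g y) = ennreal (- r) * ennreal (- g y)" for y
    using ennreal_mult'[of "- r" "- g y"] by simp
  with False show ?thesis
    by (simp add: nn_integral_cmult measurable_\<kappa>[OF x] ennreal_neg)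
qed

text \<open>
  A Fubini theorem for signed product functions. Existence of the double integral makes one of the
  integrals \<open>a(x)\<close>, \<open>b(x)\<close> of the two parts of \<open>f(x) g(y)\<close> over the fibre finite for almost every \<open>x\<close>, so
  \<open>f(x) R(g)(x) = a(x) - b(x)\<close> there, and this difference may be integrated term by term.
\<close>

lemma ext_integral_mult_R_op:
  assumes [measurable]: "f \<in> borel_measurable \<mu>" "g \<in> borel_measurable \<mu>"
    and ex: "ext_integral_exists \<rho> (\<lambda>(x, y). ereal (f x * g y))"
  shows "ext_integral \<mu> (\<lambda>x. ereal (f x) * R_op \<kappa> g x) = ext_integral \<rho> (\<lambda>(x, y). ereal (f x * g y))"
proof -
  define a where "a x = (\<integral>\<^sup>+y. ennreal (f x * g y) \<partial>\<kappa> x)" for x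
  define b where "b x = (\<integral>\<^sup>+y. ennreal (- (f x * g y)) \<partial>\<kappa> x)" for x
  have G [measurable]: "(\<lambda>x. \<integral>\<^sup>+y. ennreal (g y) \<partial>\<kappa> x) \<in> borel_measurable \<mu>"
    "(\<lambda>x. \<integral>\<^sup>+y. ennreal (- g y) \<partial>\<kappa> x) \<in> borel_measurable \<mu>"
    by (auto intro!: measurable_nn_integral_\<kappa>)
  have a_eq: "a x = ennreal (f x) * (\<integral>\<^sup>+y. ennreal (g y) \<partial>\<kappa> x) + ennreal (- f x) * (\<integral>\<^sup>+y. ennreal (- g y) \<partial>\<kappa> x)"
    and b_eq: "b x = ennreal (- f x) * (\<integral>\<^sup>+y. ennreal (g y) \<partial>\<kappa> x) + ennreal (f x) * (\<integral>\<^sup>+y. ennreal (- g y) \<partial>\<kappa> x)"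
    if "x \<in> space \<mu>" for x
    using nn_integral_\<kappa>_mult[OF that, of g "f x"] nn_integral_\<kappa>_mult[OF that, of g "- f x"]
    by (simp_all add: a_def b_def)
  have [measurable]: "a \<in> borel_measurable \<mu>" "b \<in> borel_measurable \<mu>"
    using a_eq b_eq by (simp_all cong: measurable_cong)
  have A: "(\<integral>\<^sup>+x. a x \<partial>\<mu>) = (\<integral>\<^sup>+(x, y). ennreal (f x * g y) \<partial>\<rho>)"
    and B: "(\<integral>\<^sup>+x. b x \<partial>\<mu>) = (\<integral>\<^sup>+(x, y). ennreal (- (f x * g y)) \<partial>\<rho>)"
    by (simp_all add: nn_integral_\<rho> a_def b_def)
  have "ext_integral \<mu> (\<lambda>x. ereal (f x) * R_op \<kappa> g x) = enn2ereal (\<integral>\<^sup>+x. a x \<partial>\<mu>) - enn2ereal (\<integral>\<^sup>+x. b x \<partial>\<mu>)"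
  proof (rule ext_integral_diff)
    show "(\<integral>\<^sup>+x. a x \<partial>\<mu>) < \<infinity> \<or> (\<integral>\<^sup>+x. b x \<partial>\<mu>) < \<infinity>"
      using ex unfolding A B ext_integral_exists_def by (simp add: case_prod_unfold)
    show "AE x in \<mu>. a x < \<infinity> \<or> b x < \<infinity> \<longrightarrow> ereal (f x) * R_op \<kappa> g x = enn2ereal (a x) - enn2ereal (b x)"
      using AE_space
    proof eventually_elim
      fix x assume "x \<in> space \<mu>"
      then show "a x < \<infinity> \<or> b x < \<infinity> \<longrightarrow> ereal (f x) * R_op \<kappa> g x = enn2ereal (a x) - enn2ereal (b x)"
        using ereal_mult_diff_enn2ereal[of "f x"]
        by (simp add: a_eq b_eq R_op_def ext_integral_def)
    qed
  qed measurable
  also have "\<dots> = ext_integral \<rho> (\<lambda>(x, y). ereal (f x * g y))"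
    unfolding A B by (simp add: ext_integral_def case_prod_unfold)
  finally show ?thesis .
qed

lemma ext_integral_indicator_R_op:
  assumes [measurable]: "A \<in> sets \<mu>" "B \<in> sets \<mu>"
  shows "ext_integral \<mu> (\<lambda>x. ereal (indicator A x) * R_op \<kappa> (indicator B) x) = enn2ereal (emeasure \<rho> (A \<times> B))"
proof -
  have "(\<lambda>(x, y). ereal (indicator A x * indicator B y)) = (\<lambda>z. ereal (indicator (A \<times> B) z))"
    by (auto simp: indicator_def)
  moreover have "e2ennreal (ereal (- indicator (A \<times> B) z)) = 0" for z :: "'a \<times> 'a"
    by (simp add: ennreal_neg)
  ultimately show ?thesis
    by (subst ext_integral_mult_R_op)
       (simp_all add: ext_integral_exists_def ext_integral_nonneg ennreal_indicator)
qed

text \<open>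
  Both sides of the operator identity are double integrals, of \<open>f(x) g(y)\<close> and of \<open>f(y) g(x)\<close>; the
  reflection exchanges them. Conversely, indicators turn the identity into symmetry on rectangles.
\<close>

lemma symmetric_operator_iff_symmetric:
  "symmetric_operator \<mu> \<rho> (R_op \<kappa>) \<longleftrightarrow> symmetric_measure \<mu> \<rho>"
proof
  assume sym: "symmetric_measure \<mu> \<rho>"
  show "symmetric_operator \<mu> \<rho> (R_op \<kappa>)"
    unfolding symmetric_operator_def
  proof (intro ballI impI)
    fix f g assume [measurable]: "f \<in> borel_measurable \<mu>" "g \<in> borel_measurable \<mu>"
      and ex: "ext_integral_exists \<rho> (\<lambda>(x, y). ereal (f x * g y))"
        "ext_integral_exists \<rho> (\<lambda>(x, y). ereal (f y * g x))"
    have swap: "(\<integral>\<^sup>+(x, y). ennreal (s * (f x * g y)) \<partial>\<rho>) = (\<integral>\<^sup>+(x, y). ennreal (s * (f y * g x)) \<partial>\<rho>)" for s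
      using nn_integral_swap[OF sym, of "\<lambda>(x, y). ennreal (s * (f x * g y))"] by simp
    have "ext_integral \<mu> (\<lambda>x. ereal (f x) * R_op \<kappa> g x) = ext_integral \<rho> (\<lambda>(x, y). ereal (f x * g y))"
      by (rule ext_integral_mult_R_op) (use ex in auto)
    also have "\<dots> = ext_integral \<rho> (\<lambda>(x, y). ereal (g x * f y))"
      using swap[of 1] swap[of "- 1"] by (simp add: ext_integral_def case_prod_unfold mult.commute)
    also have "\<dots> = ext_integral \<mu> (\<lambda>x. ereal (g x) * R_op \<kappa> f x)"
      by (rule ext_integral_mult_R_op[symmetric]) (use ex in \<open>auto simp: mult.commute\<close>)
    finally show "ext_integral \<mu> (\<lambda>x. ereal (f x) * R_op \<kappa> g x) = ext_integral \<mu> (\<lambda>x. R_op \<kappa> f x * ereal (g x))"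
      by (simp add: mult.commute)
  qed
next
  assume op: "symmetric_operator \<mu> \<rho> (R_op \<kappa>)"
  have "emeasure \<rho> (A \<times> B) = emeasure \<rho> (B \<times> A)" if [measurable]: "A \<in> sets \<mu>" "B \<in> sets \<mu>" for A B
  proof -
    have "ext_integral_exists \<rho> (\<lambda>(x, y). ereal (indicator A x * indicator B y))"
      "ext_integral_exists \<rho> (\<lambda>(x, y). ereal (indicator A y * indicator B x))"
      by (simp_all add: ext_integral_exists_def case_prod_unfold ennreal_neg)
    with op have "ext_integral \<mu> (\<lambda>x. ereal (indicator A x) * R_op \<kappa> (indicator B) x) =
        ext_integral \<mu> (\<lambda>x. R_op \<kappa> (indicator A) x * ereal (indicator B x))"
      unfolding symmetric_operator_def by simp
    then show ?thesis
      using ext_integral_indicator_R_op[of A B] ext_integral_indicator_R_op[of B A] that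
      by (simp add: mult.commute enn2ereal_inject)
  qed
  then show "symmetric_measure \<mu> \<rho>"
    by (simp add: symmetric_measure_def)
qed

section \<open>The operator \<open>P\<close> and the measure \<open>\<nu> = c\<mu>\<close>\<close>

lemma mass_mult_P_op:
  assumes "0 < fibre_mass \<kappa> x" "fibre_mass \<kappa> x < \<infinity>"
  shows "enn2ereal (fibre_mass \<kappa> x) * P_op \<kappa> f x = R_op \<kappa> f x"
  using assms unfolding P_op_def
  by (cases "fibre_mass \<kappa> x"; cases "R_op \<kappa> f x") (auto simp: divide_ereal_def ereal_mult_divide)

lemma emeasure_\<rho>_eq_ext_integral:
  assumes "A \<in> sets \<mu>" "B \<in> sets \<mu>"
  shows "enn2ereal (emeasure \<rho> (A \<times> B)) =
    ext_integral \<mu> (\<lambda>x. ereal (indicator A x) * (enn2ereal (fibre_mass \<kappa> x) * P_op \<kappa> (indicator B) x))"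
  unfolding ext_integral_indicator_R_op[OF assms, symmetric]
  using mass by (intro ext_integral_cong_AE) (auto simp: mass_mult_P_op)


lemma sets_nu [measurable_cong, simp]: "sets (nu \<mu> \<kappa>) = sets \<mu>"
  by (simp add: nu_def)

lemma measurable_nu: "borel_measurable (nu \<mu> \<kappa>) = borel_measurable \<mu>"
  by (rule measurable_cong_sets) simp_all

lemma AE_nu: "(AE x in nu \<mu> \<kappa>. Q x) \<longleftrightarrow> (AE x in \<mu>. Q x)"
  unfolding nu_def AE_density[OF measurable_fibre_mass]
proof
  show "AE x in \<mu>. Q x" if "AE x in \<mu>. 0 < fibre_mass \<kappa> x \<longrightarrow> Q x"
    using that mass by eventually_elim simp
qed auto

lemma nn_integral_nu:
  "f \<in> borel_measurable \<mu> \<Longrightarrow> (\<integral>\<^sup>+x. f x \<partial>nu \<mu> \<kappa>) = (\<integral>\<^sup>+x. fibre_mass \<kappa> x * f x \<partial>\<mu>)"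
  by (simp add: nu_def nn_integral_density)

lemma nn_integral_\<rho>_fst:
  assumes [measurable]: "f \<in> borel_measurable \<mu>"
  shows "(\<integral>\<^sup>+(x, y). f x \<partial>\<rho>) = (\<integral>\<^sup>+x. f x \<partial>nu \<mu> \<kappa>)"
  by (simp add: nn_integral_\<rho> nn_integral_nu)
     (intro nn_integral_cong, simp add: fibre_mass_def mult.commute)

lemma nn_integral_\<rho>_snd:
  assumes "symmetric_measure \<mu> \<rho>" and [measurable]: "f \<in> borel_measurable \<mu>"
  shows "(\<integral>\<^sup>+(x, y). f y \<partial>\<rho>) = (\<integral>\<^sup>+x. f x \<partial>nu \<mu> \<kappa>)"
  using nn_integral_swap[OF assms(1), of "\<lambda>(x, y). f x"] by (simp add: nn_integral_\<rho>_fst)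

lemma measurable_P_op:
  assumes [measurable]: "f \<in> borel_measurable \<mu>"
  shows "P_op \<kappa> f \<in> borel_measurable \<mu>"
proof -
  note measurable_R_op[measurable]
  show ?thesis
    unfolding P_op_def[abs_def] by measurable
qed

lemma mass_mult_e2ennreal_P_op:
  assumes "0 < fibre_mass \<kappa> x" "fibre_mass \<kappa> x < \<infinity>"
  shows "fibre_mass \<kappa> x * e2ennreal (P_op \<kappa> f x) = e2ennreal (R_op \<kappa> f x)"
  using mass_mult_P_op[OF assms] by (simp flip: e2ennreal_enn2ereal_mult)

text \<open>
  The two marginals of a symmetric \<open>\<rho>\<close> coincide. The first is \<open>\<nu>\<close>, and the second is \<open>\<nu>P\<close>.
\<close>

lemma invariant_of_symmetric:
  assumes sym: "symmetric_measure \<mu> \<rho>"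
  shows "invariant_measure (nu \<mu> \<kappa>) (P_op \<kappa>)"
  unfolding invariant_measure_def
proof (intro ballI impI)
  fix f :: "'a \<Rightarrow> real" assume f: "f \<in> borel_measurable (nu \<mu> \<kappa>)" "\<forall>x\<in>space (nu \<mu> \<kappa>). 0 \<le> f x"
  then have [measurable]: "f \<in> borel_measurable \<mu>" and nonneg: "\<And>x. x \<in> space \<mu> \<Longrightarrow> 0 \<le> f x"
    by (auto simp: measurable_nu nu_def)
  note measurable_P_op[measurable]
  have R: "R_op \<kappa> f x = enn2ereal (\<integral>\<^sup>+y. ennreal (f y) \<partial>\<kappa> x)" if "x \<in> space \<mu>" for x
    using that nonneg unfolding R_op_def
    by (subst ext_integral_nonneg) (auto intro!: AE_I2 simp: space_\<kappa>)
  have pos: "AE x in nu \<mu> \<kappa>. 0 \<le> P_op \<kappa> f x"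
    unfolding AE_nu by (intro AE_I2) (simp add: P_op_def R)
  have "(\<integral>\<^sup>+x. e2ennreal (P_op \<kappa> f x) \<partial>nu \<mu> \<kappa>) = (\<integral>\<^sup>+x. (\<integral>\<^sup>+y. ennreal (f y) \<partial>\<kappa> x) \<partial>\<mu>)"
    using mass AE_space
    by (subst nn_integral_nu) (auto intro!: nn_integral_cong_AE simp: mass_mult_e2ennreal_P_op R)
  also have "\<dots> = (\<integral>\<^sup>+x. ennreal (f x) \<partial>nu \<mu> \<kappa>)"
    using nn_integral_\<rho>_snd[OF sym, of "\<lambda>x. ennreal (f x)"] by (simp add: nn_integral_\<rho>)
  finally show "ext_integral (nu \<mu> \<kappa>) (P_op \<kappa> f) = ext_integral (nu \<mu> \<kappa>) (\<lambda>x. ereal (f x))"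
    using f(2) by (simp add: ext_integral_nonneg pos AE_I2)
qed

text \<open>
  The Cauchy-Schwarz inequality on a single fibre, against the constant function \<open>1\<close>, whose square has
  integral \<open>c(x)\<close>.
\<close>

lemma real_P_op_bound:
  assumes x: "x \<in> space \<mu>" and c: "0 < fibre_mass \<kappa> x" "fibre_mass \<kappa> x < \<infinity>"
    and f [measurable]: "f \<in> borel_measurable \<mu>"
    and F: "(\<integral>\<^sup>+y. ennreal ((f y)\<^sup>2) \<partial>\<kappa> x) < \<infinity>"
  shows "\<bar>P_op \<kappa> f x\<bar> \<noteq> \<infinity>"
    and "fibre_mass \<kappa> x * ennreal ((real_of_ereal (P_op \<kappa> f x))\<^sup>2) \<le> (\<integral>\<^sup>+y. ennreal ((f y)\<^sup>2) \<partial>\<kappa> x)"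
proof -
  have fx [measurable]: "f \<in> borel_measurable (\<kappa> x)"
    by (simp add: measurable_\<kappa> x)
  define S where "S = (\<integral>\<^sup>+y. ennreal \<bar>f y\<bar> \<partial>\<kappa> x)"
  have "S\<^sup>2 = (\<integral>\<^sup>+y. ennreal \<bar>f y\<bar> * 1 \<partial>\<kappa> x)\<^sup>2"
    by (simp add: S_def)
  also have "\<dots> \<le> (\<integral>\<^sup>+y. (ennreal \<bar>f y\<bar>)\<^sup>2 \<partial>\<kappa> x) * (\<integral>\<^sup>+y. 1\<^sup>2 \<partial>\<kappa> x)"
    by (rule Cauchy_Schwarz_nn_integral) auto
  finally have CS: "S\<^sup>2 \<le> (\<integral>\<^sup>+y. ennreal ((f y)\<^sup>2) \<partial>\<kappa> x) * fibre_mass \<kappa> x"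
    by (simp add: fibre_mass_def ennreal_power)
  obtain c' where c': "fibre_mass \<kappa> x = ennreal c'" "0 < c'"
    using c by (cases "fibre_mass \<kappa> x") auto
  obtain F' where F': "(\<integral>\<^sup>+y. ennreal ((f y)\<^sup>2) \<partial>\<kappa> x) = ennreal F'" "0 \<le> F'"
    using F by (cases "\<integral>\<^sup>+y. ennreal ((f y)\<^sup>2) \<partial>\<kappa> x") auto
  have "S < top"
    using CS c'(2) F'(2) unfolding c'(1) F'(1)
    by (cases S) (auto simp: ennreal_mult[symmetric] top_unique power2_eq_square)
  then obtain s where s: "S = ennreal s" "0 \<le> s"
    by (cases S) auto
  have s2: "s\<^sup>2 \<le> F' * c'"
    using CS F'(2) c'(2) unfolding c' F' s by (simp add: ennreal_power s ennreal_mult[symmetric])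
  have "(\<integral>\<^sup>+y. ennreal (f y) \<partial>\<kappa> x) \<le> S" "(\<integral>\<^sup>+y. ennreal (- f y) \<partial>\<kappa> x) \<le> S"
    unfolding S_def by (auto intro!: nn_integral_mono ennreal_leI)
  then obtain p q where pq: "(\<integral>\<^sup>+y. ennreal (f y) \<partial>\<kappa> x) = ennreal p" "0 \<le> p" "p \<le> s"
    "(\<integral>\<^sup>+y. ennreal (- f y) \<partial>\<kappa> x) = ennreal q" "0 \<le> q" "q \<le> s"
    unfolding s using s(2)
    by (cases "\<integral>\<^sup>+y. ennreal (f y) \<partial>\<kappa> x"; cases "\<integral>\<^sup>+y. ennreal (- f y) \<partial>\<kappa> x") (auto simp: top_unique)
  have P: "P_op \<kappa> f x = ereal ((p - q) / c')"
    using pq c' by (simp add: P_op_def R_op_def ext_integral_def one_ereal_def)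
  then show "\<bar>P_op \<kappa> f x\<bar> \<noteq> \<infinity>"
    by simp
  have "(p - q)\<^sup>2 \<le> s\<^sup>2"
    using pq by (intro power2_le_iff_abs_le[THEN iffD2]) auto
  then have "c' * ((p - q) / c')\<^sup>2 \<le> F'"
    using s2 c'(2) by (simp add: power_divide power2_eq_square divide_simps)
  then show "fibre_mass \<kappa> x * ennreal ((real_of_ereal (P_op \<kappa> f x))\<^sup>2) \<le> (\<integral>\<^sup>+y. ennreal ((f y)\<^sup>2) \<partial>\<kappa> x)"
    using c'(2) F'(2) by (simp add: P c'(1) F'(1) ennreal_mult[symmetric])
qed

text \<open>
  Integrating the fibrewise bound shows that \<open>P\<close> is a contraction of \<open>L\<^sup>2(\<nu>)\<close>, because the second marginal
  of a symmetric \<open>\<rho>\<close> is \<open>\<nu>\<close>.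
\<close>

lemma P_op_L2:
  assumes sym: "symmetric_measure \<mu> \<rho>" and f: "f \<in> L2 (nu \<mu> \<kappa>)"
  shows "AE x in nu \<mu> \<kappa>. \<bar>P_op \<kappa> f x\<bar> \<noteq> \<infinity>" and "(\<lambda>x. real_of_ereal (P_op \<kappa> f x)) \<in> L2 (nu \<mu> \<kappa>)"
proof -
  have [measurable]: "f \<in> borel_measurable \<mu>"
    using f by (simp add: L2_def measurable_nu)
  note measurable_P_op[measurable] measurable_nn_integral_\<kappa>[measurable]
  have "(\<integral>\<^sup>+x. (\<integral>\<^sup>+y. ennreal ((f y)\<^sup>2) \<partial>\<kappa> x) \<partial>\<mu>) = (\<integral>\<^sup>+x. ennreal ((f x)\<^sup>2) \<partial>nu \<mu> \<kappa>)"
    using nn_integral_\<rho>_snd[OF sym, of "\<lambda>x. ennreal ((f x)\<^sup>2)"] by (simp add: nn_integral_\<rho>)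
  also have "\<dots> < \<infinity>"
    using f by (simp add: L2_def integrable_iff_bounded)
  finally have fin: "(\<integral>\<^sup>+x. (\<integral>\<^sup>+y. ennreal ((f y)\<^sup>2) \<partial>\<kappa> x) \<partial>\<mu>) < \<infinity>" .
  have fib: "AE x in \<mu>. (\<integral>\<^sup>+y. ennreal ((f y)\<^sup>2) \<partial>\<kappa> x) < \<infinity>"
    using nn_integral_PInf_AE[OF _ fin[THEN less_imp_neq]] by (simp add: less_top measurable_nn_integral_\<kappa>)
  then show "AE x in nu \<mu> \<kappa>. \<bar>P_op \<kappa> f x\<bar> \<noteq> \<infinity>"
    unfolding AE_nu using mass AE_space
  proof eventually_elim
    case (elim x)
    then show ?case by (intro real_P_op_bound(1)) auto
  qed
  have "(\<integral>\<^sup>+x. ennreal ((real_of_ereal (P_op \<kappa> f x))\<^sup>2) \<partial>nu \<mu> \<kappa>) \<le> (\<integral>\<^sup>+x. (\<integral>\<^sup>+y. ennreal ((f y)\<^sup>2) \<partial>\<kappa> x) \<partial>\<mu>)"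
  proof (subst nn_integral_nu)
    show "(\<integral>\<^sup>+x. fibre_mass \<kappa> x * ennreal ((real_of_ereal (P_op \<kappa> f x))\<^sup>2) \<partial>\<mu>)
      \<le> (\<integral>\<^sup>+x. (\<integral>\<^sup>+y. ennreal ((f y)\<^sup>2) \<partial>\<kappa> x) \<partial>\<mu>)"
    proof (rule nn_integral_mono_AE)
      show "AE x in \<mu>. fibre_mass \<kappa> x * ennreal ((real_of_ereal (P_op \<kappa> f x))\<^sup>2)
        \<le> (\<integral>\<^sup>+y. ennreal ((f y)\<^sup>2) \<partial>\<kappa> x)"
        using mass AE_space fib
      proof eventually_elim
        case (elim x)
        then show ?case by (intro real_P_op_bound(2)) auto
      qed
    qed
  qed measurable
  with fin show "(\<lambda>x. real_of_ereal (P_op \<kappa> f x)) \<in> L2 (nu \<mu> \<kappa>)"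
    by (simp add: L2_def integrable_iff_bounded measurable_nu)
qed

text \<open>
  The density \<open>c\<close> of \<open>\<nu>\<close> cancels the factor \<open>1/c\<close> of \<open>P\<close>, so an inner product in \<open>L\<^sup>2(\<nu>)\<close> becomes an integral
  of \<open>g R(f)\<close> over \<open>\<mu>\<close>, to which the results on \<open>R\<close> apply.
\<close>

lemma integral_P_op_mult:
  assumes [measurable]: "f \<in> borel_measurable \<mu>" "g \<in> borel_measurable \<mu>"
    and int: "integrable (nu \<mu> \<kappa>) (\<lambda>x. real_of_ereal (P_op \<kappa> f x) * g x)"
    and fin: "AE x in nu \<mu> \<kappa>. \<bar>P_op \<kappa> f x\<bar> \<noteq> \<infinity>"
  shows "(\<integral>x. real_of_ereal (P_op \<kappa> f x) * g x \<partial>nu \<mu> \<kappa>) =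
    real_of_ereal (ext_integral \<mu> (\<lambda>x. ereal (g x) * R_op \<kappa> f x))"
proof -
  note measurable_P_op[measurable]
  define h where "h x = real_of_ereal (P_op \<kappa> f x) * g x" for x
  have [measurable]: "h \<in> borel_measurable \<mu>"
    unfolding h_def by measurable
  have R: "AE x in \<mu>. ereal (g x) * R_op \<kappa> f x = enn2ereal (fibre_mass \<kappa> x) * ereal (h x)"
    using mass fin[unfolded AE_nu]
  proof eventually_elim
    fix x assume c: "0 < fibre_mass \<kappa> x \<and> fibre_mass \<kappa> x < \<infinity>" and P: "\<bar>P_op \<kappa> f x\<bar> \<noteq> \<infinity>"
    have "R_op \<kappa> f x = enn2ereal (fibre_mass \<kappa> x) * P_op \<kappa> f x"
      using c by (simp add: mass_mult_P_op)
    moreover have "P_op \<kappa> f x = ereal (real_of_ereal (P_op \<kappa> f x))"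
      using P by (simp add: ereal_real)
    ultimately show "ereal (g x) * R_op \<kappa> f x = enn2ereal (fibre_mass \<kappa> x) * ereal (h x)"
      unfolding h_def by (metis mult.assoc mult.commute times_ereal.simps(1))
  qed
  have pos: "(\<integral>\<^sup>+x. ennreal (h x) \<partial>nu \<mu> \<kappa>) = (\<integral>\<^sup>+x. e2ennreal (ereal (g x) * R_op \<kappa> f x) \<partial>\<mu>)"
    using R by (subst nn_integral_nu) (auto intro!: nn_integral_cong_AE simp: e2ennreal_enn2ereal_mult)
  have neg: "(\<integral>\<^sup>+x. ennreal (- h x) \<partial>nu \<mu> \<kappa>) = (\<integral>\<^sup>+x. e2ennreal (- (ereal (g x) * R_op \<kappa> f x)) \<partial>\<mu>)"
  proof (subst nn_integral_nu)
    show "(\<integral>\<^sup>+x. fibre_mass \<kappa> x * ennreal (- h x) \<partial>\<mu>) = (\<integral>\<^sup>+x. e2ennreal (- (ereal (g x) * R_op \<kappa> f x)) \<partial>\<mu>)"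
      using R
    proof (intro nn_integral_cong_AE, eventually_elim)
      fix x assume "ereal (g x) * R_op \<kappa> f x = enn2ereal (fibre_mass \<kappa> x) * ereal (h x)"
      then have "- (ereal (g x) * R_op \<kappa> f x) = enn2ereal (fibre_mass \<kappa> x) * ereal (- h x)"
        by (simp flip: ereal_mult_minus_right uminus_ereal.simps(1))
      then show "fibre_mass \<kappa> x * ennreal (- h x) = e2ennreal (- (ereal (g x) * R_op \<kappa> f x))"
        by (simp add: e2ennreal_enn2ereal_mult)
    qed
  qed measurable
  have h: "integrable (nu \<mu> \<kappa>) h"
    using int by (simp add: h_def[abs_def])
  have diff: "enn2real a - enn2real b = real_of_ereal (enn2ereal a - enn2ereal b)"
    if "a \<noteq> \<infinity>" "b \<noteq> \<infinity>" for a b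
    using that by (cases a; cases b) auto
  have "(\<integral>x. h x \<partial>nu \<mu> \<kappa>) = real_of_ereal (ext_integral \<mu> (\<lambda>x. ereal (g x) * R_op \<kappa> f x))"
    using h unfolding real_lebesgue_integral_def[OF h] ext_integral_def pos[symmetric] neg[symmetric]
    by (intro diff) (auto simp: real_integrable_def)
  then show ?thesis
    by (simp add: h_def)
qed

text \<open>
  For \<open>f, g \<in> L\<^sup>2(\<nu>)\<close> the function \<open>f(x) g(y)\<close> is dominated by \<open>f(x)\<^sup>2 + g(y)\<^sup>2\<close>, which has finite \<open>\<rho>\<close>-integral
  since both marginals are \<open>\<nu>\<close>. So the double integrals exist and symmetry of \<open>R\<close> applies.
\<close>

lemma self_adjoint_of_symmetric:
  assumes sym: "symmetric_measure \<mu> \<rho>"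
  shows "self_adjoint_on_L2 (nu \<mu> \<kappa>) (P_op \<kappa>)"
  unfolding self_adjoint_on_L2_def
proof (intro conjI ballI)
  fix f g assume fg: "f \<in> L2 (nu \<mu> \<kappa>)" "g \<in> L2 (nu \<mu> \<kappa>)"
  have inner: "(\<integral>x. real_of_ereal (P_op \<kappa> f x) * g x \<partial>nu \<mu> \<kappa>) =
      real_of_ereal (ext_integral \<mu> (\<lambda>x. ereal (g x) * R_op \<kappa> f x))"
    if "f \<in> L2 (nu \<mu> \<kappa>)" "g \<in> L2 (nu \<mu> \<kappa>)" for f g
    using that P_op_L2[OF sym that(1)]
    by (intro integral_P_op_mult L2_mult_integrable) (auto simp: L2_def measurable_nu)
  have ex: "ext_integral_exists \<rho> (\<lambda>(x, y). ereal (f x * g y))"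
    if fg: "f \<in> L2 (nu \<mu> \<kappa>)" "g \<in> L2 (nu \<mu> \<kappa>)" for f g
  proof -
    have [measurable]: "f \<in> borel_measurable \<mu>" "g \<in> borel_measurable \<mu>"
      using fg by (auto simp: L2_def measurable_nu)
    have le: "a * b \<le> a\<^sup>2 + b\<^sup>2" for a b :: real
      using abs_mult_le_sum_squares[of a b] by linarith
    have "(\<integral>\<^sup>+(x, y). ennreal (f x * g y) \<partial>\<rho>) \<le> (\<integral>\<^sup>+(x, y). ennreal ((f x)\<^sup>2) + ennreal ((g y)\<^sup>2) \<partial>\<rho>)"
      by (intro nn_integral_mono) (auto simp: le simp flip: ennreal_plus intro!: ennreal_leI)
    also have "\<dots> = (\<integral>\<^sup>+(x, y). ennreal ((f x)\<^sup>2) \<partial>\<rho>) + (\<integral>\<^sup>+(x, y). ennreal ((g y)\<^sup>2) \<partial>\<rho>)"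
      by (simp add: case_prod_unfold nn_integral_add)
    also have "\<dots> = (\<integral>\<^sup>+x. ennreal ((f x)\<^sup>2) \<partial>nu \<mu> \<kappa>) + (\<integral>\<^sup>+x. ennreal ((g x)\<^sup>2) \<partial>nu \<mu> \<kappa>)"
      by (simp add: nn_integral_\<rho>_fst nn_integral_\<rho>_snd[OF sym])
    also have "\<dots> < \<infinity>"
      using fg by (simp add: L2_def integrable_iff_bounded)
    finally show ?thesis
      by (simp add: ext_integral_exists_def case_prod_unfold)
  qed
  have "ext_integral \<mu> (\<lambda>x. ereal (f x) * R_op \<kappa> g x) = ext_integral \<mu> (\<lambda>x. R_op \<kappa> f x * ereal (g x))"
  proof -
    have "ext_integral_exists \<rho> (\<lambda>(x, y). ereal (f y * g x))"
      using ex[OF fg(2,1)] by (subst mult.commute)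
    then show ?thesis
      using symmetric_operator_iff_symmetric sym fg ex[OF fg]
      by (simp add: symmetric_operator_def L2_def measurable_nu)
  qed
  then show "(\<integral>x. real_of_ereal (P_op \<kappa> f x) * g x \<partial>nu \<mu> \<kappa>) = (\<integral>x. f x * real_of_ereal (P_op \<kappa> g x) \<partial>nu \<mu> \<kappa>)"
    using inner[OF fg] inner[OF fg(2,1)] by (simp only: mult.commute[of "f _"] mult.commute[of "R_op \<kappa> f _"])
qed (use P_op_L2[OF sym] in auto)

text \<open>
  Self-adjointness tested on indicators gives symmetry on rectangles whose sides have finite
  \<open>\<nu>\<close>-measure; \<open>\<nu>(A) = \<rho>(A \<times> V)\<close>. Only these indicators lie in \<open>L\<^sup>2(\<nu>)\<close>, so the general case follows by
  continuity from below along an exhaustion.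
\<close>

lemma symmetric_of_self_adjoint:
  assumes sa: "self_adjoint_on_L2 (nu \<mu> \<kappa>) (P_op \<kappa>)"
  shows "symmetric_measure \<mu> \<rho>"
proof -
  have *: "emeasure \<rho> (A \<times> B) = emeasure \<rho> (B \<times> A)"
    if AB [measurable]: "A \<in> sets \<mu>" "B \<in> sets \<mu>"
      and fin: "emeasure \<rho> (A \<times> space \<mu>) < \<infinity>" "emeasure \<rho> (B \<times> space \<mu>) < \<infinity>" for A B
  proof -
    have L2: "indicator C \<in> L2 (nu \<mu> \<kappa>)"
      if [measurable]: "C \<in> sets \<mu>" and "emeasure \<rho> (C \<times> space \<mu>) < \<infinity>" for C
    proof -
      have "emeasure (nu \<mu> \<kappa>) C = (\<integral>\<^sup>+x. indicator C x \<partial>nu \<mu> \<kappa>)"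
        by simp
      also have "\<dots> = (\<integral>\<^sup>+(x, y). indicator C x \<partial>\<rho>)"
        by (rule nn_integral_\<rho>_fst[symmetric]) measurable
      also have "\<dots> = (\<integral>\<^sup>+z. indicator (C \<times> space \<mu>) z \<partial>\<rho>)"
        by (intro nn_integral_cong) (auto simp: space_\<rho> indicator_def)
      also have "\<dots> = emeasure \<rho> (C \<times> space \<mu>)"
        by simp
      finally have "emeasure (nu \<mu> \<kappa>) C < \<infinity>"
        using that(2) by simp
      moreover have "(indicator C x)\<^sup>2 = (indicator C x :: real)" for x
        by (simp add: indicator_def)
      ultimately show ?thesis
        by (simp add: L2_def measurable_nu)
    qed
    have inner: "(\<integral>x. real_of_ereal (P_op \<kappa> (indicator C) x) * indicator D x \<partial>nu \<mu> \<kappa>) = enn2real (emeasure \<rho> (D \<times> C))"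
      if [measurable]: "C \<in> sets \<mu>" "D \<in> sets \<mu>" and "emeasure \<rho> (C \<times> space \<mu>) < \<infinity>" "emeasure \<rho> (D \<times> space \<mu>) < \<infinity>" for C D
    proof -
      have CD: "indicator C \<in> L2 (nu \<mu> \<kappa>)" "indicator D \<in> L2 (nu \<mu> \<kappa>)"
        using that by (auto intro: L2)
      then have "AE x in nu \<mu> \<kappa>. \<bar>P_op \<kappa> (indicator C) x\<bar> \<noteq> \<infinity>"
        "(\<lambda>x. real_of_ereal (P_op \<kappa> (indicator C) x)) \<in> L2 (nu \<mu> \<kappa>)"
        using sa by (simp_all add: self_adjoint_on_L2_def)
      then have "(\<integral>x. real_of_ereal (P_op \<kappa> (indicator C) x) * indicator D x \<partial>nu \<mu> \<kappa>) =
          real_of_ereal (ext_integral \<mu> (\<lambda>x. ereal (indicator D x) * R_op \<kappa> (indicator C) x))"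
        using CD by (intro integral_P_op_mult L2_mult_integrable) simp_all
      then show ?thesis
        by (simp add: ext_integral_indicator_R_op)
    qed
    have "(\<integral>x. real_of_ereal (P_op \<kappa> (indicator A) x) * indicator B x \<partial>nu \<mu> \<kappa>) =
        (\<integral>x. indicator A x * real_of_ereal (P_op \<kappa> (indicator B) x) \<partial>nu \<mu> \<kappa>)"
      using sa L2[OF AB(1) fin(1)] L2[OF AB(2) fin(2)] by (simp add: self_adjoint_on_L2_def)
    then have "enn2real (emeasure \<rho> (B \<times> A)) = enn2real (emeasure \<rho> (A \<times> B))"
      using inner[OF AB fin] inner[OF AB(2,1) fin(2,1)] by (simp add: mult.commute)
    moreover have "emeasure \<rho> (A \<times> B) \<le> emeasure \<rho> (A \<times> space \<mu>)" "emeasure \<rho> (B \<times> A) \<le> emeasure \<rho> (B \<times> space \<mu>)"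
      using sets.sets_into_space[OF AB(1)] sets.sets_into_space[OF AB(2)] by (auto intro!: emeasure_mono)
    ultimately show ?thesis
      using fin by (metis ennreal_enn2real infinity_ennreal_def order_le_less_trans)
  qed
  obtain E :: "nat \<Rightarrow> 'a set" where E: "range E \<subseteq> sets \<mu>" "incseq E" "(\<Union>n. E n) = space \<mu>"
    "\<And>n. emeasure \<rho> (E n \<times> space \<mu>) < \<infinity>"
    using exhaustion by metis
  have E_sets [measurable]: "E n \<in> sets \<mu>" for n
    using E(1) by auto
  have cover: "emeasure \<rho> (A \<times> B) = (SUP n. emeasure \<rho> ((A \<inter> E n) \<times> (B \<inter> E n)))"
    if AB [measurable]: "A \<in> sets \<mu>" "B \<in> sets \<mu>" for A B
  proof -
    have "A \<times> B = (\<Union>n. (A \<inter> E n) \<times> (B \<inter> E n))"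
    proof (intro equalityI subsetI)
      fix z assume z: "z \<in> A \<times> B"
      then obtain m n where "fst z \<in> E m" "snd z \<in> E n"
        using E(3) sets.sets_into_space[OF AB(1)] sets.sets_into_space[OF AB(2)] by fastforce
      then have "fst z \<in> E (max m n)" "snd z \<in> E (max m n)"
        using incseqD[OF E(2), of m "max m n"] incseqD[OF E(2), of n "max m n"] by auto
      with z show "z \<in> (\<Union>n. (A \<inter> E n) \<times> (B \<inter> E n))"
        by (auto intro!: exI[of _ "max m n"] simp: mem_Times_iff)
    qed auto
    moreover have "incseq (\<lambda>n. (A \<inter> E n) \<times> (B \<inter> E n))"
      using E(2) by (auto simp: incseq_def)
    ultimately show ?thesis
      by (subst SUP_emeasure_incseq) (auto simp: sets_\<rho>)
  qed
  show ?thesis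
    unfolding symmetric_measure_def
  proof (intro ballI)
    fix A B assume [measurable]: "A \<in> sets \<mu>" "B \<in> sets \<mu>"
    have fin: "emeasure \<rho> ((C \<inter> E n) \<times> space \<mu>) < \<infinity>" if [measurable]: "C \<in> sets \<mu>" for C n
      using emeasure_mono[of "(C \<inter> E n) \<times> space \<mu>" "E n \<times> space \<mu>" \<rho>] E(4)[of n]
      by (auto simp: sets_\<rho> intro: order_le_less_trans)
    show "emeasure \<rho> (A \<times> B) = emeasure \<rho> (B \<times> A)"
      by (subst (1 2) cover) (auto intro!: SUP_cong * fin)
  qed
qed

end

section \<open>Equivalent descriptions of reversibility\<close>

theorem proposition4p21:
  fixes \<mu> :: "'a measure" and \<rho> :: "('a \<times> 'a) measure" and \<kappa> :: "'a \<Rightarrow> 'a measure"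
  assumes "standard_borel_space \<mu>"
    and "sigma_finite_measure \<mu>"
    and "non_atomic \<mu>"
    and "has_fibres \<rho> \<mu> \<kappa>"
    and "AE x in \<mu>. 0 < fibre_mass \<kappa> x \<and> fibre_mass \<kappa> x < \<infinity>"
    and "\<And>A. A \<in> sets \<mu> \<Longrightarrow> emeasure \<mu> A < \<infinity> \<Longrightarrow> (\<integral>\<^sup>+x\<in>A. fibre_mass \<kappa> x \<partial>\<mu>) < \<infinity>"
  shows
    "(reversible \<mu> \<kappa> \<longleftrightarrow>
       self_adjoint_on_L2 (nu \<mu> \<kappa>) (P_op \<kappa>) \<and> invariant_measure (nu \<mu> \<kappa>) (P_op \<kappa>)) \<and>
     (reversible \<mu> \<kappa> \<longleftrightarrow> detailed_balance \<mu> \<kappa>) \<and>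
     (reversible \<mu> \<kappa> \<longleftrightarrow>
       (\<forall>A\<in>sets \<mu>. \<forall>B\<in>sets \<mu>. enn2ereal (emeasure \<rho> (A \<times> B)) =
          ext_integral \<mu> (\<lambda>x. ereal (indicator A x) *
            (enn2ereal (fibre_mass \<kappa> x) * P_op \<kappa> (indicator B) x))) \<and>
       symmetric_measure \<mu> \<rho>) \<and>
     (reversible \<mu> \<kappa> \<longleftrightarrow> symmetric_operator \<mu> \<rho> (R_op \<kappa>))"
proof -
  interpret fibred_measure \<mu> \<rho> \<kappa>
    using assms by (simp add: fibred_measure_def fibred_measure_axioms_def)
  show ?thesis
    unfolding reversible_iff_symmetric detailed_balance_iff_symmetric symmetric_operator_iff_symmetric
    using self_adjoint_of_symmetric invariant_of_symmetric symmetric_of_self_adjoint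
      emeasure_\<rho>_eq_ext_integral
    by blast
qed

end
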